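(* Consider, for $\gamma>0$, the system $$\dot x=x-\frac{xy}{(1+\alpha x)(1+\beta y)},\qquad \dot y=-\gamma y+\frac{xy}{(1+\alpha x)(1+\beta y)}$$ along the Bogdanov--Takens curve $$x_0=(1+\gamma)^2,\quad y_0=\frac{(1+\gamma)^2}{\gamma},\quad \alpha=\frac{\gamma}{(1+\gamma)^2},\quad \beta=\frac1{(1+\gamma)^2},$$ and choose $q_0=(\gamma,1)^\top$, $q_1=(1+\gamma,0)^\top$. Then the distinguished restriction at the equilibrium $(x_0,y_0)$ is $$\mathcal R_B(u)=\frac{\gamma^3u^2\bigl((1+\gamma)^2+\gamma u\bigr)}{\bigl((1+\gamma)^3+\gamma u\bigr)\bigl((1+\gamma)^3+\gamma^2u\bigr)}.$$ For every $\gamma>0$ the numerator is coprime with the denominator, and hence the recurrence degree is $d_B=2$. Moreover, the quadratic Taylor coefficient of $\mathcal R_B$ is $$g_2=\frac{\gamma^3}{(1+\gamma)^4}=a(\gamma),$$ in agreement with the intrinsic quadratic Bogdanov--Takens coefficient $a(\gamma)$.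
   Context: Here $(x_0,y_0)$ is an equilibrium whose Jacobian $A$ is nonzero with $A^2=0$, and $Aq_0=0$, $Aq_1=q_0$. With $\mathcal X$ denoting the vector field, the distinguished restriction is the scalar function near $0$ defined by $A\,\mathcal X\bigl((x_0,y_0)+uq_0\bigr)=\mathcal R_B(u)q_0$; equivalently, writing $(x,y)^\top=(x_0,y_0)^\top+uq_0+vq_1$, it is the second component $\dot v$ of the transformed system evaluated at $v=0$. Recurrence degree: writing a nonzero rational restriction as $\mathcal R(u)=u^2P(u)/Q(u)$ with $\gcd(P,Q)=1$, $Q(0)\neq0$, it is $\deg Q$. The intrinsic quadratic Bogdanov--Takens coefficient along the curve, known from the literature, is $a(\gamma)=\gamma^3/(1+\gamma)^4$. *)

theory Defs
  imports "HOL-Analysis.Analysis" "HOL-Computational_Algebra.Polynomial_Factorial" "HOL-Computational_Algebra.Field_as_Ring"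
begin

definition predator_prey_field :: "real \<Rightarrow> real \<Rightarrow> real \<Rightarrow> real^2 \<Rightarrow> real^2" where
  "predator_prey_field \<gamma> \<alpha> \<beta> z =
     vector [z$1 - z$1 * z$2 / ((1 + \<alpha> * z$1) * (1 + \<beta> * z$2)),
             - \<gamma> * z$2 + z$1 * z$2 / ((1 + \<alpha> * z$1) * (1 + \<beta> * z$2))]"

definition bt_equilibrium :: "(real^2 \<Rightarrow> real^2) \<Rightarrow> real^2 \<Rightarrow> real^2 \<Rightarrow> real^2 \<Rightarrow> bool" where
  "bt_equilibrium X p q0 q1 \<longleftrightarrow>
     X p = 0 \<and> X differentiable (at p) \<and>
     jacobian X (at p) \<noteq> 0 \<and> jacobian X (at p) ** jacobian X (at p) = 0 \<and>
     q0 \<noteq> 0 \<and> jacobian X (at p) *v q0 = 0 \<and> jacobian X (at p) *v q1 = q0"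

(* At a Bogdanov--Takens equilibrium the range of the Jacobian is the line spanned by q0,
   so the described scalar exists and is unique for every u. *)
definition distinguished_restriction ::
    "(real^2 \<Rightarrow> real^2) \<Rightarrow> real^2 \<Rightarrow> real^2 \<Rightarrow> real \<Rightarrow> real" where
  "distinguished_restriction X p q0 u =
     (THE r. jacobian X (at p) *v X (p + u *\<^sub>R q0) = r *\<^sub>R q0)"

(* The restriction is a germ at 0, hence equality is only required near 0. *)
definition reduced_fraction :: "(real \<Rightarrow> real) \<Rightarrow> real poly \<Rightarrow> real poly \<Rightarrow> bool" where
  "reduced_fraction R P Q \<longleftrightarrow>
     P \<noteq> 0 \<and> coprime P Q \<and> poly Q 0 \<noteq> 0 \<and>
     (\<forall>\<^sub>F u in nhds 0. R u = u^2 * poly P u / poly Q u)"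

definition recurrence_degree :: "(real \<Rightarrow> real) \<Rightarrow> nat" where
  "recurrence_degree R = (THE d. \<exists>P Q. reduced_fraction R P Q \<and> d = degree Q)"

(* The known value of the intrinsic quadratic Bogdanov--Takens coefficient along the curve. *)
definition bt_quadratic_coefficient :: "real \<Rightarrow> real" where
  "bt_quadratic_coefficient \<gamma> = \<gamma>^3 / (1 + \<gamma>)^4"

lemma matrix_range_eq_span:
  fixes A :: "real^2^2"
  assumes "A *v q0 = 0" "A *v q1 = q0" "q0 \<noteq> 0"
  shows "\<exists>!r. A *v z = r *\<^sub>R q0"
proof -
  have D: "a = 0 \<and> b = 0" if h: "a *\<^sub>R q0 + b *\<^sub>R q1 = 0" for a b
  proof -
    have "A *v (a *\<^sub>R q0 + b *\<^sub>R q1) = b *\<^sub>R q0"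
      using assms by (simp add: matrix_vector_right_distrib scaleR_matrix_vector_assoc matrix_vector_mult_scaleR)
    then have "b *\<^sub>R q0 = 0" using h by simp
    then show ?thesis using assms h by auto
  qed
  have ne: "q0 \<noteq> q1" using D[of 1 "-1"] by auto
  have "independent {q0, q1}"
  proof -
    have "q0 \<notin> span {q1}"
      using D[of 1] by (auto simp: span_singleton) (metis add.right_inverse scaleR_left.minus)
    moreover have "q1 \<noteq> 0" using D[of 0 1] by auto
    ultimately show ?thesis by (simp add: independent_insert)
  qed
  then have "span {q0, q1} = UNIV"
    using card_eq_dim[of "{q0, q1}" UNIV] ne by (simp add: top.extremum_unique)
  then obtain a b where "z = a *\<^sub>R q0 + b *\<^sub>R q1"
  proof -
    assume *: "\<And>a b. z = a *\<^sub>R q0 + b *\<^sub>R q1 \<Longrightarrow> thesis"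
    have "z \<in> span {q0, q1}" using \<open>span {q0, q1} = UNIV\<close> by simp
    then obtain a b where "z - a *\<^sub>R q0 = b *\<^sub>R q1"
      by (auto simp: span_breakdown_eq span_singleton)
    then show thesis using *[of a b] by (simp add: diff_eq_eq add.commute)
  qed
  then have "A *v z = b *\<^sub>R q0"
    using assms by (simp add: matrix_vector_right_distrib matrix_vector_mult_scaleR)
  then show ?thesis using assms(3) by (intro ex1I[of _ b]) auto
qed

lemma distinguished_restriction_eqI:
  assumes "q0 \<noteq> 0" "jacobian X (at p) *v X (p + u *\<^sub>R q0) = r *\<^sub>R q0"
  shows "distinguished_restriction X p q0 u = r"
  unfolding distinguished_restriction_def using assms by (intro the_equality) auto

lemma distinguished_restriction_eq_vdot:
  assumes "bt_equilibrium X p q0 q1" "X (p + u *\<^sub>R q0) = du *\<^sub>R q0 + dv *\<^sub>R q1"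
  shows "distinguished_restriction X p q0 u = dv"
  using assms by (intro distinguished_restriction_eqI)
    (auto simp: bt_equilibrium_def matrix_vector_right_distrib matrix_vector_mult_scaleR)

lemma reduced_fraction_degree_unique:
  assumes "reduced_fraction R P Q" "reduced_fraction R P' Q'"
  shows "degree Q = degree Q'"
proof -
  have "\<forall>\<^sub>F u in nhds 0. poly Q u \<noteq> 0" "\<forall>\<^sub>F u in nhds 0. poly Q' u \<noteq> 0"
    using assms unfolding reduced_fraction_def
    by (auto intro!: tendsto_imp_eventually_ne poly_isCont[unfolded isCont_def] simp: eventually_nhds_conv_at)
  moreover have "\<forall>\<^sub>F u in nhds 0. R u = u^2 * poly P u / poly Q u"
    "\<forall>\<^sub>F u in nhds 0. R u = u^2 * poly P' u / poly Q' u"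
    using assms by (auto simp: reduced_fraction_def)
  ultimately have "\<forall>\<^sub>F u in nhds 0. poly ([:0,0,1:] * (P * Q' - P' * Q)) u = 0"
    by eventually_elim (auto simp: field_simps power2_eq_square)
  then obtain e where e: "e > 0" "\<And>u. dist u 0 < e \<Longrightarrow> poly ([:0,0,1:] * (P * Q' - P' * Q)) u = 0"
    unfolding eventually_nhds_metric by blast
  have "infinite {0<..<e}" using e by simp
  moreover have "{0<..<e} \<subseteq> {u. poly ([:0,0,1:] * (P * Q' - P' * Q)) u = 0}"
    using e by (intro subsetI CollectI e(2)) (auto simp: dist_norm)
  ultimately have "infinite {u. poly ([:0,0,1:] * (P * Q' - P' * Q)) u = 0}"
    using finite_subset by blast
  then have "[:0,0,1:] * (P * Q' - P' * Q) = 0"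
    using poly_roots_finite by blast
  then have eq: "P * Q' = P' * Q" by simp
  have "Q dvd P * Q'" "Q' dvd P' * Q"
    using eq by (metis dvd_triv_right)+
  then have "Q dvd Q'" "Q' dvd Q"
    using assms by (auto simp: reduced_fraction_def coprime_commute coprime_dvd_mult_right_iff)
  moreover have "Q \<noteq> 0" "Q' \<noteq> 0" using assms by (auto simp: reduced_fraction_def)
  ultimately show ?thesis by (simp add: dvd_imp_degree_le order_antisym)
qed

lemma recurrence_degree_eqI:
  assumes "reduced_fraction R P Q"
  shows "recurrence_degree R = degree Q"
  unfolding recurrence_degree_def using assms
  by (intro the_equality) (auto intro: reduced_fraction_degree_unique)

end

theory Submission
  imports Defs
begin

text \<open>
  Write \<open>s = 1 + \<gamma>\<close>, let \<open>F\<close> be the predation term \<open>x y / ((1 + \<alpha> x) (1 + \<beta> y))\<close>, and consider the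
  line \<open>p + u q\<^sub>0\<close> along the kernel direction of the Jacobian. The identity \<open>x = \<gamma> y\<close> holds at \<open>p\<close> and
  along \<open>q\<^sub>0\<close>, so it holds on the whole line: with \<open>w = x = s\<^sup>2 + \<gamma> u\<close>, growth of the prey and decay of
  the predators both equal \<open>w\<close>, and the field there is \<open>(w - F) (1, -1) = (w - F) (q\<^sub>1 - q\<^sub>0)\<close>. The
  distinguished restriction is the component along \<open>q\<^sub>1\<close>, namely \<open>w - F\<close>. Clearing denominators with
  \<open>D\<^sub>1 = s\<^sup>3 + \<gamma> u\<close> and \<open>D\<^sub>2 = s\<^sup>3 + \<gamma>\<^sup>2 u\<close> gives \<open>F = w\<^sup>2 s\<^sup>4 / (D\<^sub>1 D\<^sub>2)\<close>, and
  \<open>D\<^sub>1 D\<^sub>2 - s\<^sup>4 w = \<gamma>\<^sup>3 u\<^sup>2\<close> because the terms of degree at most one in \<open>u\<close> cancel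
  (\<open>\<gamma> + \<gamma>\<^sup>2 = \<gamma> s\<close>). Hence the restriction is \<open>\<gamma>\<^sup>3 u\<^sup>2 w / (D\<^sub>1 D\<^sub>2)\<close>.

  Coprimality reduces to pairs of linear polynomials: \<open>w\<close> shares a root with \<open>D\<^sub>1\<close> only if \<open>s = 1\<close> and
  with \<open>D\<^sub>2\<close> only if \<open>s = \<gamma>\<close>, both excluded by \<open>\<gamma> > 0\<close>; the factor \<open>u\<close> divides neither \<open>D\<^sub>1\<close> nor \<open>D\<^sub>2\<close>
  because \<open>s \<noteq> 0\<close>. The degree of \<open>D\<^sub>1 D\<^sub>2\<close> is then the recurrence degree, and the quadratic Taylor
  coefficient of \<open>u\<^sup>2 P / Q\<close> is \<open>P(0) / Q(0) = \<gamma>\<^sup>3 s\<^sup>2 / s\<^sup>6\<close>.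
\<close>

section \<open>The Jacobian\<close>

lemma has_derivative_imp_jacobian:
  fixes f :: "real^'n \<Rightarrow> real^'m"
  assumes "(f has_derivative (\<lambda>h. A *v h)) (at z)"
  shows "jacobian f (at z) = A"
  unfolding jacobian_def
  using frechet_derivative_at[OF assms] by (metis matrix_of_matrix_vector_mul)

lemma DERIV_saturation:
  fixes a t :: real
  assumes "1 + a * t \<noteq> 0"
  shows "((\<lambda>t. t / (1 + a * t)) has_real_derivative 1 / (1 + a * t)\<^sup>2) (at t)"
  using assms by (auto intro!: derivative_eq_intros simp: power2_eq_square)

text \<open>The predation term is a product of a function of the prey and a function of the predators, each
  saturating; this makes the partial derivatives short.\<close>

lemma predator_prey_field_has_derivative:
  fixes \<gamma> \<alpha> \<beta> :: real and z :: "real^2"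
  assumes "1 + \<alpha> * z$1 \<noteq> 0" "1 + \<beta> * z$2 \<noteq> 0"
  defines "a \<equiv> z$2 / (1 + \<beta> * z$2) / (1 + \<alpha> * z$1)\<^sup>2"
    and "b \<equiv> z$1 / (1 + \<alpha> * z$1) / (1 + \<beta> * z$2)\<^sup>2"
  shows "(predator_prey_field \<gamma> \<alpha> \<beta> has_derivative
           (\<lambda>h. vector [vector [1 - a, - b], vector [a, - \<gamma> + b]] *v h)) (at z)"
proof -
  define F where "F w = w$1 / (1 + \<alpha> * w$1) * (w$2 / (1 + \<beta> * w$2))" for w :: "real^2"
  have nth: "((\<lambda>w :: real^2. w $ i) has_derivative (\<lambda>h. h $ i)) (at z)" for i
    by (intro bounded_linear_imp_has_derivative bounded_linear_vec_nth)
  have "((\<lambda>w. w$1 / (1 + \<alpha> * w$1)) has_derivative (\<lambda>h. 1 / (1 + \<alpha> * z$1)\<^sup>2 * h$1)) (at z)"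
    using has_derivative_compose[OF nth DERIV_saturation[OF assms(1), unfolded has_field_derivative_def]] .
  moreover have "((\<lambda>w. w$2 / (1 + \<beta> * w$2)) has_derivative (\<lambda>h. 1 / (1 + \<beta> * z$2)\<^sup>2 * h$2)) (at z)"
    using has_derivative_compose[OF nth DERIV_saturation[OF assms(2), unfolded has_field_derivative_def]] .
  ultimately have F: "(F has_derivative (\<lambda>h. a * h$1 + b * h$2)) (at z)"
    unfolding F_def a_def b_def
    by (rule has_derivative_eq_rhs[OF has_derivative_mult]) (simp add: fun_eq_iff mult.commute)
  have X: "predator_prey_field \<gamma> \<alpha> \<beta> =
      (\<lambda>w. (w$1 - F w) *\<^sub>R axis 1 1 + (- \<gamma> * w$2 + F w) *\<^sub>R axis 2 1)"
    by (auto simp: predator_prey_field_def F_def fun_eq_iff vec_eq_iff forall_2 axis_def)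
  show ?thesis
    unfolding X
    by (rule derivative_eq_intros nth F refl)+
      (auto simp: fun_eq_iff vec_eq_iff forall_2 axis_def matrix_vector_mult_def sum_2 algebra_simps)
qed

section \<open>The Bogdanov--Takens point and its restriction\<close>

text \<open>Along the curve the Jacobian is the rank-one matrix \<open>(1 / (1 + \<gamma>)) q\<^sub>0 (1, -\<gamma>)\<close>, whose row \<open>(1, -\<gamma>)\<close>
  annihilates \<open>q\<^sub>0\<close>; hence its square vanishes.\<close>

lemma bt_equilibrium_predator_prey:
  fixes \<gamma> :: real
  assumes "\<gamma> > 0"
  shows "bt_equilibrium (predator_prey_field \<gamma> (\<gamma> / (1 + \<gamma>)\<^sup>2) (1 / (1 + \<gamma>)\<^sup>2))
    (vector [(1 + \<gamma>)\<^sup>2, (1 + \<gamma>)\<^sup>2 / \<gamma>]) (vector [\<gamma>, 1]) (vector [1 + \<gamma>, 0])"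
    (is "bt_equilibrium ?X ?p ?q0 ?q1")
proof -
  define s where "s = 1 + \<gamma>"
  have s: "s > 0" and g: "\<gamma> > 0" using assms by (auto simp: s_def)
  have denoms: "1 + \<gamma> / s\<^sup>2 * s\<^sup>2 = s" "1 + 1 / s\<^sup>2 * (s\<^sup>2 / \<gamma>) = s / \<gamma>"
    using s g by (auto simp: s_def field_simps)
  define A :: "real^2^2" where
    "A = vector [vector [\<gamma> / s, - \<gamma>\<^sup>2 / s], vector [1 / s, - \<gamma> / s]]"
  have "(?X has_derivative (\<lambda>h. A *v h)) (at ?p)"
  proof -
    have ratio: "1 - 1 / s = \<gamma> / s"
      using s by (simp add: s_def field_simps)
    have entries: "1 - s\<^sup>2 / \<gamma> / (s / \<gamma>) / s\<^sup>2 = \<gamma> / s" "s\<^sup>2 / s / (s / \<gamma>)\<^sup>2 = \<gamma>\<^sup>2 / s"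
      "s\<^sup>2 / \<gamma> / (s / \<gamma>) / s\<^sup>2 = 1 / s" "- \<gamma> + \<gamma>\<^sup>2 / s = - \<gamma> / s"
      using s g by (auto simp: field_simps power2_eq_square) (auto simp: s_def algebra_simps)
    show ?thesis
      using predator_prey_field_has_derivative[of "\<gamma> / s\<^sup>2" ?p "1 / s\<^sup>2" \<gamma>] s g
      unfolding s_def[symmetric] vector_2 denoms entries by (simp add: A_def ratio)
  qed
  then have J: "jacobian ?X (at ?p) = A" and diff: "?X differentiable (at ?p)"
    by (auto intro: has_derivative_imp_jacobian differentiableI)
  have "?X ?p = 0"
    unfolding predator_prey_field_def s_def[symmetric] vector_2 denoms
    using s g by (auto simp: vec_eq_iff forall_2 field_simps power2_eq_square)
  moreover have "A \<noteq> 0" "A ** A = 0" "?q0 \<noteq> 0" "A *v ?q0 = 0" "A *v ?q1 = ?q0"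
    using s g
    by (auto simp: A_def vec_eq_iff forall_2 matrix_matrix_mult_def matrix_vector_mult_def sum_2
        power2_eq_square s_def[symmetric])
  ultimately show ?thesis
    by (simp add: bt_equilibrium_def J diff)
qed

lemma distinguished_restriction_predator_prey:
  fixes \<gamma> u :: real
  assumes "\<gamma> > 0" and "((1 + \<gamma>)^3 + \<gamma> * u) * ((1 + \<gamma>)^3 + \<gamma>\<^sup>2 * u) \<noteq> 0"
  shows "distinguished_restriction (predator_prey_field \<gamma> (\<gamma> / (1 + \<gamma>)\<^sup>2) (1 / (1 + \<gamma>)\<^sup>2))
      (vector [(1 + \<gamma>)\<^sup>2, (1 + \<gamma>)\<^sup>2 / \<gamma>]) (vector [\<gamma>, 1]) u =
    \<gamma>^3 * u\<^sup>2 * ((1 + \<gamma>)\<^sup>2 + \<gamma> * u) / (((1 + \<gamma>)^3 + \<gamma> * u) * ((1 + \<gamma>)^3 + \<gamma>\<^sup>2 * u))"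
    (is "distinguished_restriction ?X ?p ?q0 u = ?R")
proof -
  define s where "s = 1 + \<gamma>"
  have s: "s > 0" and g: "\<gamma> > 0" using assms by (auto simp: s_def)
  define w where "w = s\<^sup>2 + \<gamma> * u"
  define D1 where "D1 = s^3 + \<gamma> * u"
  define D2 where "D2 = s^3 + \<gamma>\<^sup>2 * u"
  have D: "D1 \<noteq> 0" "D2 \<noteq> 0" using assms by (auto simp: D1_def D2_def s_def)
  have point: "(?p + u *\<^sub>R ?q0) $ 1 = w" "(?p + u *\<^sub>R ?q0) $ 2 = w / \<gamma>"
    using g by (simp_all add: w_def s_def[symmetric] add_divide_distrib mult.commute)
  have sat: "1 + \<gamma> / s\<^sup>2 * w = D2 / s\<^sup>2" "1 + 1 / s\<^sup>2 * (w / \<gamma>) = D1 / (\<gamma> * s\<^sup>2)"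
  proof -
    have "s\<^sup>2 + \<gamma> * w = D2" "\<gamma> * s\<^sup>2 + w = D1"
      by (simp_all add: w_def D1_def D2_def s_def algebra_simps power2_eq_square power3_eq_cube)
    then show "1 + \<gamma> / s\<^sup>2 * w = D2 / s\<^sup>2" "1 + 1 / s\<^sup>2 * (w / \<gamma>) = D1 / (\<gamma> * s\<^sup>2)"
      using s g by (simp_all add: field_simps)
  qed
  \<comment> \<open>The source of the factor \<open>u\<^sup>2\<close>: the restriction vanishes to second order.\<close>
  have cancel: "D1 * D2 - s^4 * w = \<gamma>^3 * u\<^sup>2"
    by (simp add: D1_def D2_def w_def s_def algebra_simps eval_nat_numeral)
  have "w * (w / \<gamma>) / (D2 / s\<^sup>2 * (D1 / (\<gamma> * s\<^sup>2))) = s^4 * w\<^sup>2 / (D1 * D2)"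
    using s g D by (simp add: field_simps eval_nat_numeral)
  then have "w - w * (w / \<gamma>) / (D2 / s\<^sup>2 * (D1 / (\<gamma> * s\<^sup>2))) = w * (D1 * D2 - s^4 * w) / (D1 * D2)"
    using D by (simp add: field_simps power2_eq_square)
  also have "\<dots> = ?R"
    unfolding cancel by (simp add: w_def D1_def D2_def s_def mult_ac)
  finally have pred: "w * (w / \<gamma>) / (D2 / s\<^sup>2 * (D1 / (\<gamma> * s\<^sup>2))) = w - ?R" by simp
  have "?X (?p + u *\<^sub>R ?q0) = vector [?R, - ?R]"
    unfolding predator_prey_field_def point
    unfolding s_def[symmetric] sat pred[unfolded s_def[symmetric]]
    using g by simp
  also have "\<dots> = (- ?R) *\<^sub>R ?q0 + ?R *\<^sub>R vector [1 + \<gamma>, 0]"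
    by (simp only: vec_eq_iff forall_2) (simp add: distrib_left)
  finally show ?thesis
    by (rule distinguished_restriction_eq_vdot[OF bt_equilibrium_predator_prey[OF g]])
qed

section \<open>Reduced fractions\<close>

text \<open>Eliminating the variable from two linear polynomials leaves their resultant, a unit.\<close>

lemma coprime_linear_polys:
  fixes a b c d :: "'a :: {field, field_gcd}"
  assumes "a * d \<noteq> b * c"
  shows "coprime [:a, b:] [:c, d:]"
proof (rule coprimeI)
  fix r assume "r dvd [:a, b:]" "r dvd [:c, d:]"
  then have "r dvd smult d [:a, b:] - smult b [:c, d:]"
    by (intro dvd_diff dvd_smult)
  also have "smult d [:a, b:] - smult b [:c, d:] = [:a * d - b * c:]"
    by (simp add: mult.commute)
  finally show "is_unit r"
    using assms by (auto elim!: dvd_unit_imp_unit simp: is_unit_const_poly_iff dvd_field_iff)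
qed

lemma poly_has_fps_expansion:
  fixes P :: "'a :: {banach, real_normed_field} poly"
  shows "poly P has_fps_expansion fps_of_poly P"
proof (induction P)
  case 0
  then show ?case by simp
next
  case (pCons a P)
  have "(\<lambda>x. a + x * poly P x) has_fps_expansion fps_const a + fps_X * fps_of_poly P"
    by (intro fps_expansion_intros pCons.IH)
  then show ?case by (simp add: fps_of_poly_pCons add.commute mult.commute)
qed

text \<open>As \<open>Q(0) \<noteq> 0\<close>, the series of \<open>Q\<close> is invertible, so the factor \<open>u\<^sup>2\<close> shifts the constant coefficient
  of \<open>P / Q\<close> to position two.\<close>

lemma reduced_fraction_fps_expansion:
  assumes "reduced_fraction R P Q"
  shows "\<exists>G. R has_fps_expansion G \<and> fps_nth G 2 = poly P 0 / poly Q 0"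
proof (intro exI conjI)
  let ?G = "fps_X ^ 2 * (fps_of_poly P * inverse (fps_of_poly Q))"
  have "(\<lambda>u. u^2 * (poly P u * inverse (poly Q u))) has_fps_expansion ?G"
    using assms unfolding reduced_fraction_def
    by (intro fps_expansion_intros poly_has_fps_expansion) (simp add: poly_0_coeff_0)
  moreover have "\<forall>\<^sub>F u in nhds 0. R u = u^2 * (poly P u * inverse (poly Q u))"
    using assms by (simp add: reduced_fraction_def divide_inverse mult.assoc)
  ultimately show "R has_fps_expansion ?G"
    unfolding has_fps_expansion_def by (auto elim: eventually_elim2)
  show "fps_nth ?G 2 = poly P 0 / poly Q 0"
    by (simp add: fps_X_power_mult_nth poly_0_coeff_0 divide_inverse)
qed

section \<open>Degree and Taylor coefficient along the Bogdanov--Takens curve\<close>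

theorem proposition6p10:
  fixes \<gamma> x\<^sub>0 y\<^sub>0 \<alpha> \<beta> :: real and X :: "real^2 \<Rightarrow> real^2" and p q\<^sub>0 q\<^sub>1 :: "real^2" and R\<^sub>B :: "real \<Rightarrow> real"
  assumes "\<gamma> > 0"
    and "x\<^sub>0 = (1 + \<gamma>)^2" and "y\<^sub>0 = (1 + \<gamma>)^2 / \<gamma>"
    and "\<alpha> = \<gamma> / (1 + \<gamma>)^2" and "\<beta> = 1 / (1 + \<gamma>)^2"
    and "X = predator_prey_field \<gamma> \<alpha> \<beta>"
    and "p = vector [x\<^sub>0, y\<^sub>0]"
    and "q\<^sub>0 = vector [\<gamma>, 1]" and "q\<^sub>1 = vector [1 + \<gamma>, 0]"
    and "R\<^sub>B = distinguished_restriction X p q\<^sub>0"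
  shows "bt_equilibrium X p q\<^sub>0 q\<^sub>1 \<and>
    (\<forall>u. ((1 + \<gamma>)^3 + \<gamma> * u) * ((1 + \<gamma>)^3 + \<gamma>^2 * u) \<noteq> 0 \<longrightarrow>
       R\<^sub>B u = \<gamma>^3 * u^2 * ((1 + \<gamma>)^2 + \<gamma> * u)
               / (((1 + \<gamma>)^3 + \<gamma> * u) * ((1 + \<gamma>)^3 + \<gamma>^2 * u))) \<and>
    coprime (monom (\<gamma>^3) 2 * [:(1 + \<gamma>)^2, \<gamma>:])
            ([:(1 + \<gamma>)^3, \<gamma>:] * [:(1 + \<gamma>)^3, \<gamma>^2:]) \<and>
    recurrence_degree R\<^sub>B = 2 \<and>
    (\<exists>G. R\<^sub>B has_fps_expansion G \<and> fps_nth G 2 = \<gamma>^3 / (1 + \<gamma>)^4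
       \<and> fps_nth G 2 = bt_quadratic_coefficient \<gamma>)"
proof -
  define s where "s = 1 + \<gamma>"
  have g: "\<gamma> > 0" and s: "s > 0" using assms(1) by (auto simp: s_def)
  define w where "w = [:s^2, \<gamma>:]"
  define D where "D = [:s^3, \<gamma>:] * [:s^3, \<gamma>^2:]"
  have equilibrium: "bt_equilibrium X p q\<^sub>0 q\<^sub>1"
    using bt_equilibrium_predator_prey[OF g] by (simp add: assms(2-9))
  have formula: "R\<^sub>B u = \<gamma>^3 * u^2 * ((1 + \<gamma>)^2 + \<gamma> * u)
      / (((1 + \<gamma>)^3 + \<gamma> * u) * ((1 + \<gamma>)^3 + \<gamma>^2 * u))"
    if "((1 + \<gamma>)^3 + \<gamma> * u) * ((1 + \<gamma>)^3 + \<gamma>^2 * u) \<noteq> 0" for u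
    using distinguished_restriction_predator_prey[OF g that] by (simp add: assms(2-10))
  have "coprime w D"
  proof -
    have "s^2 * \<gamma> \<noteq> \<gamma> * s^3" "s^2 * \<gamma>^2 \<noteq> \<gamma> * s^3"
    proof -
      have "\<gamma> * s^3 = s^2 * \<gamma> * s" "s^2 * \<gamma>^2 = s^2 * \<gamma> * \<gamma>"
        by (simp_all add: power2_eq_square power3_eq_cube)
      moreover have "s \<noteq> 1" "s \<noteq> \<gamma>" "s^2 * \<gamma> \<noteq> 0"
        using g s by (simp_all add: s_def)
      ultimately show "s^2 * \<gamma> \<noteq> \<gamma> * s^3" "s^2 * \<gamma>^2 \<noteq> \<gamma> * s^3"
        by (metis mult_cancel_left mult_cancel_left1 mult.right_neutral)+
    qed
    then show ?thesis
      by (auto simp: w_def D_def coprime_linear_polys simp del: mult_pCons_left mult_pCons_right)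
  qed
  have const: "coprime [:\<gamma>^3:] D"
    using g by (intro is_unit_left_imp_coprime) (simp add: is_unit_const_poly_iff dvd_field_iff)
  have "coprime [:0, 1:] D"
    using s unfolding D_def coprime_mult_right_iff by (auto intro!: coprime_linear_polys)
  moreover have "monom (\<gamma>^3) 2 = [:\<gamma>^3:] * [:0, 1:]^2"
    by (simp add: monom_altdef)
  ultimately have "coprime (monom (\<gamma>^3) 2) D"
    using const by (simp only: coprime_mult_left_iff coprime_power_left_iff) simp
  with \<open>coprime w D\<close> have coprime_num: "coprime (monom (\<gamma>^3) 2 * w) D"
    by simp
  have D0: "poly D 0 = s^6"
    by (simp add: D_def eval_nat_numeral)
  have reduced: "reduced_fraction R\<^sub>B ([:\<gamma>^3:] * w) D"
    unfolding reduced_fraction_def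
  proof (intro conjI)
    show "[:\<gamma>^3:] * w \<noteq> 0" using g by (simp add: w_def)
    show "coprime ([:\<gamma>^3:] * w) D"
      using const \<open>coprime w D\<close> by (simp only: coprime_mult_left_iff)
    show "poly D 0 \<noteq> 0" using s by (simp add: D0)
    then have "\<forall>\<^sub>F u in nhds 0. poly D u \<noteq> 0"
      by (auto intro!: tendsto_imp_eventually_ne poly_isCont[unfolded isCont_def]
          simp: eventually_nhds_conv_at)
    then show "\<forall>\<^sub>F u in nhds 0. R\<^sub>B u = u^2 * poly ([:\<gamma>^3:] * w) u / poly D u"
    proof eventually_elim
      case (elim u)
      have D: "poly D u = ((1 + \<gamma>)^3 + \<gamma> * u) * ((1 + \<gamma>)^3 + \<gamma>^2 * u)"
        unfolding D_def s_def by (simp only: poly_mult) (simp add: mult.commute)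
      have N: "u^2 * poly ([:\<gamma>^3:] * w) u = \<gamma>^3 * u^2 * ((1 + \<gamma>)^2 + \<gamma> * u)"
        by (simp add: w_def s_def algebra_simps)
      show ?case
        using formula[of u] elim unfolding D N by blast
    qed
  qed
  have "degree D = 2"
    using g unfolding D_def by (subst degree_mult_eq) auto
  then have degree: "recurrence_degree R\<^sub>B = 2"
    using recurrence_degree_eqI[OF reduced] by simp
  obtain G where G: "R\<^sub>B has_fps_expansion G"
    "fps_nth G 2 = poly ([:\<gamma>^3:] * w) 0 / poly D 0"
    using reduced_fraction_fps_expansion[OF reduced] by blast
  have "poly ([:\<gamma>^3:] * w) 0 / poly D 0 = \<gamma>^3 / (1 + \<gamma>)^4"
    using s unfolding D0 by (simp add: w_def s_def[symmetric] field_simps eval_nat_numeral)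
  with G have "fps_nth G 2 = \<gamma>^3 / (1 + \<gamma>)^4" by simp
  then show ?thesis
    using equilibrium formula coprime_num degree G(1)
    unfolding w_def D_def s_def bt_quadratic_coefficient_def by blast
qed

end
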